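(* Regard two permutations as equivalent if they are torically equivalent, and let $\mathbf p$ be the bivincular pattern $(213,\varnothing,\{1\})$. For every $n\ge1$, the set $\widetilde{\mathfrak A}_n(\mathbf p)$ consists of the divisor permutations $\delta_{k|n}$ ($k$ a positive divisor of $n$) in $\mathfrak S_n$. In particular $|\widetilde{\mathfrak A}_n(\mathbf p)|=d(n)$, where $d(n)$ is the number of divisors of $n$.
   Context: For $\pi\in\mathfrak S_n$ (one-line notation $\pi_1\cdots\pi_n$) and an integer $m$, the permutation $\pi\oplus m\in\mathfrak S_n$ is defined as follows: form the circular word $0\,\pi_1\pi_2\cdots\pi_n$ on $\{0,\dots,n\}$, add $m$ modulo $n+1$ to every letter, and read the resulting circular word starting just after the letter $0$. The toric class of $\pi$ is $\{\pi\oplus m: m=0,1,\dots,n\}$, and two permutations are torically equivalent if they are in the same toric class. An occurrence of the pattern $(213,\varnothing,\{1\})$ in $\pi\in\mathfrak S_n$ is a subsequence $\pi_{a}\pi_{b}\pi_{c}$ with $a<b<c$, in the same relative order as $213$, such that $\pi_a=\pi_b+1$. A permutation avoids the pattern if it has no occurrence of it. $\widetilde{\mathfrak A}_n(\mathbf p)$ is the set of $\pi\in\mathfrak S_n$ such that $\pi$ and every permutation torically equivalent to $\pi$ avoids $\mathbf p$. For $1\le k\le n$ coprime to $n+1$, build a circular permutation of $\{0,1,\dots,n\}$ on $n+1$ circular positions by placing $0$ anywhere, and then placing each letter $m+1$ exactly $k$ steps after the letter $m$, for $m=0,\dots,n-1$. Then $\nu_{k,n}\in\mathfrak S_n$ is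 the permutation obtained by reading this circular permutation starting just after $0$; equivalently the letter $m$ is at position $mk \bmod (n+1)$. If $k$ divides $n$ (hence is coprime to $n+1$), $\delta_{k|n}=\nu_{k,n}$ is called the divisor permutation corresponding to $k|n$. *)

theory Defs
  imports Complex_Main "HOL-Combinatorics.Permutations"
begin

text \<open>
  A permutation in \<open>S\<^sub>n\<close> is a function \<open>\<pi>\<close> with \<open>\<pi> permutes {1..n}\<close>; its one-line notation is
  \<open>\<pi> 1 \<dots> \<pi> n\<close>. Circular words on \<open>{0..n}\<close> are functions on the positions \<open>0, \<dots>, n\<close>, which are
  read modulo \<open>n + 1\<close>.
\<close>

definition circ_word :: "(nat \<Rightarrow> nat) \<Rightarrow> nat \<Rightarrow> nat" where
  "circ_word \<pi> i = (if i = 0 then 0 else \<pi> i)"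

definition shifted_word :: "nat \<Rightarrow> int \<Rightarrow> (nat \<Rightarrow> nat) \<Rightarrow> nat \<Rightarrow> nat" where
  "shifted_word n m \<pi> i = nat ((int (circ_word \<pi> i) + m) mod (int n + 1))"

definition zero_pos :: "nat \<Rightarrow> (nat \<Rightarrow> nat) \<Rightarrow> nat" where
  "zero_pos n w = (THE j. j \<le> n \<and> w j = 0)"

text \<open>
  The permutation whose one-line notation is the circular word \<open>w\<close> read just after its letter \<open>0\<close>;
  it is the identity outside \<open>{1..n}\<close>, as \<open>permutes\<close> requires.
\<close>

definition read_after_zero :: "nat \<Rightarrow> (nat \<Rightarrow> nat) \<Rightarrow> nat \<Rightarrow> nat" where
  "read_after_zero n w i =
     (if i \<in> {1..n} then w ((zero_pos n w + i) mod (n + 1)) else i)"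

definition toric_shift :: "nat \<Rightarrow> (nat \<Rightarrow> nat) \<Rightarrow> int \<Rightarrow> (nat \<Rightarrow> nat)" where
  "toric_shift n \<pi> m = read_after_zero n (shifted_word n m \<pi>)"

definition toric_class :: "nat \<Rightarrow> (nat \<Rightarrow> nat) \<Rightarrow> (nat \<Rightarrow> nat) set" where
  "toric_class n \<pi> = {toric_shift n \<pi> m | m. 0 \<le> m \<and> m \<le> int n}"

definition torically_equiv :: "nat \<Rightarrow> (nat \<Rightarrow> nat) \<Rightarrow> (nat \<Rightarrow> nat) \<Rightarrow> bool" where
  "torically_equiv n \<pi> \<sigma> \<longleftrightarrow>
     (\<exists>\<rho>. \<rho> permutes {1..n} \<and> \<pi> \<in> toric_class n \<rho> \<and> \<sigma> \<in> toric_class n \<rho>)"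

text \<open>
  An occurrence of the bivincular pattern \<open>(213, \<emptyset>, {1})\<close> at the positions \<open>a < b < c\<close>: the chained
  inequality on values is the relative order \<open>213\<close>, and the bottom condition \<open>{1}\<close> makes the
  letters playing the roles of \<open>1\<close> and \<open>2\<close> consecutive.
\<close>

definition occurs_213 :: "nat \<Rightarrow> (nat \<Rightarrow> nat) \<Rightarrow> nat \<Rightarrow> nat \<Rightarrow> nat \<Rightarrow> bool" where
  "occurs_213 n \<pi> a b c \<longleftrightarrow>
     1 \<le> a \<and> a < b \<and> b < c \<and> c \<le> n \<and>
     \<pi> b < \<pi> a \<and> \<pi> a < \<pi> c \<and> \<pi> a = \<pi> b + 1"

definition avoids_213 :: "nat \<Rightarrow> (nat \<Rightarrow> nat) \<Rightarrow> bool" where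
  "avoids_213 n \<pi> \<longleftrightarrow> \<not> (\<exists>a b c. occurs_213 n \<pi> a b c)"

definition toric_avoiders :: "nat \<Rightarrow> (nat \<Rightarrow> nat) set" where
  "toric_avoiders n =
     {\<pi>. \<pi> permutes {1..n} \<and> avoids_213 n \<pi> \<and>
         (\<forall>\<sigma>. \<sigma> permutes {1..n} \<and> torically_equiv n \<pi> \<sigma> \<longrightarrow> avoids_213 n \<sigma>)}"

text \<open>
  The circular position of a letter when each letter is placed \<open>k\<close> steps after its predecessor.
  The letter \<open>0\<close> may be placed anywhere, since the word is read from there; it is placed at
  position \<open>0\<close>.
\<close>

primrec letter_pos :: "nat \<Rightarrow> nat \<Rightarrow> nat \<Rightarrow> nat" where
  "letter_pos k n 0 = 0"
| "letter_pos k n (Suc m) = (letter_pos k n m + k) mod (n + 1)"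

lemma letter_pos_eq: "letter_pos k n m = m * k mod (n + 1)"
  by (induction m) (simp_all add: mod_simps add.commute)

text \<open>Both of the following are meaningful only when \<open>k\<close> is coprime to \<open>n + 1\<close>.\<close>

definition step_word :: "nat \<Rightarrow> nat \<Rightarrow> nat \<Rightarrow> nat" where
  "step_word k n i = (THE m. m \<le> n \<and> letter_pos k n m = i)"

definition nu :: "nat \<Rightarrow> nat \<Rightarrow> (nat \<Rightarrow> nat)" where
  "nu k n = read_after_zero n (step_word k n)"

text \<open>Intended for \<open>k\<close> dividing \<open>n\<close>, which makes \<open>k\<close> coprime to \<open>n + 1\<close>.\<close>

definition divisor_perm :: "nat \<Rightarrow> nat \<Rightarrow> (nat \<Rightarrow> nat)" where
  "divisor_perm k n = nu k n"

end

theory Submission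
  imports Defs "HOL-Number_Theory.Cong"
begin

text \<open>
  Read circularly, \<open>\<pi>\<close> together with its whole toric class avoids the pattern iff, for every letter
  \<open>x\<close>, the arc of the circular word from \<open>x\<close> to \<open>x + 1\<close> descends without wrapping around. Writing
  \<open>d i\<close> for the descent modulo \<open>n + 1\<close> from position \<open>i\<close> to position \<open>i + 1\<close>, this says that
  \<open>d i + \<dots> + d (i + k i - 1) = n\<close>, where \<open>k i\<close> is the length of the arc starting at \<open>i\<close>. As
  \<open>d > 0\<close>, the end point \<open>i + k i\<close> is strictly increasing in \<open>i\<close>, so the periodic function \<open>k\<close> is
  weakly increasing, hence constant. Then \<open>d\<close> is invariant under a shift by \<open>k\<close>, which generates
  all positions, so \<open>d\<close> is a constant \<open>c\<close> with \<open>k c = n\<close>, and the word is \<open>i \<mapsto> - c i\<close>.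
\<close>

section \<open>Circular words on integer positions\<close>

text \<open>Positions are integers read modulo \<open>n + 1\<close>, so that rotations and backward
  steps need no case distinction. A permutation of \<open>{1..n}\<close> fixes \<open>0\<close>,
  hence \<open>\<pi>\<close> itself already carries the letter \<open>0\<close> at position
  \<open>0\<close>.\<close>

definition cyc :: "nat \<Rightarrow> (nat \<Rightarrow> nat) \<Rightarrow> int \<Rightarrow> int" where
  "cyc n \<pi> i = int (\<pi> (nat (i mod (int n + 1))))"

lemma circ_word_permutes: "circ_word \<pi> = \<pi>" if "\<pi> permutes {1..n}"
  using permutes_not_in[OF that, of 0] by (auto simp: circ_word_def fun_eq_iff)

lemma permutes_from_0: "\<pi> permutes {0..n}" if "\<pi> permutes {1..n}" for n :: nat
  using permutes_subset[OF that, of "{0..n}"] by auto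

lemma cyc_of_nat: "i \<le> n \<Longrightarrow> cyc n \<pi> (int i) = int (\<pi> i)"
  by (simp add: cyc_def)

lemma cyc_0: "cyc n \<pi> 0 = 0" if "\<pi> permutes {1..n}"
  using permutes_not_in[OF that, of 0] by (simp add: cyc_def)

lemma cyc_cong: "[i = j] (mod (int n + 1)) \<Longrightarrow> cyc n \<pi> i = cyc n \<pi> j"
  by (simp add: cyc_def cong_def)

lemma nat_mod_le: "nat (i mod (int n + 1)) \<le> n"
  using pos_mod_bound[of "int n + 1" i] by linarith

lemma cyc_nonneg: "0 \<le> cyc n \<pi> i"
  by (simp add: cyc_def)

lemma cyc_less: "cyc n \<pi> i < int n + 1" if "\<pi> permutes {1..n}"
  using permutes_in_image[OF permutes_from_0[OF that], of "nat (i mod (int n + 1))"] nat_mod_le[of i n]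
  by (simp add: cyc_def)

lemma cyc_mod: "cyc n \<pi> i mod (int n + 1) = cyc n \<pi> i" if "\<pi> permutes {1..n}"
  using cyc_less[OF that] cyc_nonneg by simp

lemma cyc_cong_iff:
  assumes "\<pi> permutes {1..n}"
  shows "[cyc n \<pi> i = cyc n \<pi> j] (mod (int n + 1)) \<longleftrightarrow> [i = j] (mod (int n + 1))"
proof
  assume "[cyc n \<pi> i = cyc n \<pi> j] (mod (int n + 1))"
  then have "cyc n \<pi> i = cyc n \<pi> j"
    using cyc_mod[OF assms] by (simp add: cong_def)
  then have "nat (i mod (int n + 1)) = nat (j mod (int n + 1))"
    using permutes_inj[OF assms] by (simp add: cyc_def inj_eq)
  then show "[i = j] (mod (int n + 1))"
    by (simp add: cong_def eq_nat_nat_iff)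
qed (simp add: cyc_cong[of i j])

lemma cyc_surj:
  assumes "\<pi> permutes {1..n}"
  obtains i where "i \<le> n" "[cyc n \<pi> (int i) = v] (mod (int n + 1))"
proof -
  have "nat (v mod (int n + 1)) \<in> \<pi> ` {0..n}"
    using permutes_image[OF permutes_from_0[OF assms]] nat_mod_le by simp
  then obtain i where i: "i \<le> n" "\<pi> i = nat (v mod (int n + 1))"
    by auto
  then have "[cyc n \<pi> (int i) = v] (mod (int n + 1))"
    by (simp add: cyc_of_nat cong_def)
  with i show ?thesis
    using that by blast
qed

lemma permutes_eqI_cyc:
  assumes "\<pi> permutes {1..n}" "\<sigma> permutes {1..n}"
    and "\<And>i. [cyc n \<pi> i = cyc n \<sigma> i] (mod (int n + 1))"
  shows "\<pi> = \<sigma>"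
proof
  fix i
  show "\<pi> i = \<sigma> i"
  proof (cases "i \<le> n")
    case True
    have "cyc n \<pi> (int i) = cyc n \<sigma> (int i)"
      using assms(3)[of "int i"] cyc_mod[OF assms(1)] cyc_mod[OF assms(2)] by (simp add: cong_def)
    then show ?thesis
      using True by (simp add: cyc_of_nat)
  next
    case False
    then show ?thesis
      using permutes_not_in[OF assms(1), of i] permutes_not_in[OF assms(2), of i] by simp
  qed
qed

section \<open>Toric shifts\<close>

text \<open>The letter at \<open>z\<close> is the only one that adding \<open>m\<close> turns into
  \<open>0\<close>, so reading starts just after it. Any integer representative of that position
  will do.\<close>

lemma toric_shift_eq:
  assumes \<pi>: "\<pi> permutes {1..n}" and z: "[cyc n \<pi> z + m = 0] (mod (int n + 1))" and i: "i \<in> {1..n}"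
  shows "toric_shift n \<pi> m i = nat ((cyc n \<pi> (z + int i) + m) mod (int n + 1))"
proof -
  let ?N = "int n + 1"
  have word: "shifted_word n m \<pi> j = nat ((cyc n \<pi> (int j) + m) mod ?N)" if "j \<le> n" for j
    using that by (simp add: shifted_word_def circ_word_permutes[OF \<pi>] cyc_of_nat)
  have iff: "shifted_word n m \<pi> j = 0 \<longleftrightarrow> j = nat (z mod ?N)" if j: "j \<le> n" for j
  proof -
    have "shifted_word n m \<pi> j = 0 \<longleftrightarrow> [cyc n \<pi> (int j) + m = 0] (mod ?N)"
      unfolding word[OF j] cong_def by (auto intro: antisym)
    also have "\<dots> \<longleftrightarrow> [cyc n \<pi> (int j) + m = cyc n \<pi> z + m] (mod ?N)"
      using z cong_sym cong_trans by blast
    also have "\<dots> \<longleftrightarrow> [int j = z] (mod ?N)"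
      using cyc_cong_iff[OF \<pi>] by (simp add: cong_add_rcancel)
    also have "\<dots> \<longleftrightarrow> j = nat (z mod ?N)"
      using j by (auto simp: cong_def)
    finally show ?thesis .
  qed
  have zp: "zero_pos n (shifted_word n m \<pi>) = nat (z mod ?N)"
    unfolding zero_pos_def using iff nat_mod_le by (intro the_equality) auto
  have "int ((nat (z mod ?N) + i) mod (n + 1)) = (z + int i) mod ?N"
    by (simp add: zmod_int mod_simps add.commute)
  then have "cyc n \<pi> (int ((nat (z mod ?N) + i) mod (n + 1))) = cyc n \<pi> (z + int i)"
    by (intro cyc_cong) (simp add: cong_def)
  moreover have "(nat (z mod ?N) + i) mod (n + 1) \<le> n"
    using mod_less_divisor[of "n + 1"] by (simp add: less_Suc_eq_le)
  ultimately show ?thesis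
    using i by (simp add: toric_shift_def read_after_zero_def zp word)
qed

lemma toric_shift_permutes:
  assumes \<pi>: "\<pi> permutes {1..n}"
  shows "toric_shift n \<pi> m permutes {1..n}"
proof -
  let ?N = "int n + 1" and ?\<sigma> = "toric_shift n \<pi> m"
  obtain z where z0: "[cyc n \<pi> (int z) = - m] (mod ?N)"
    using cyc_surj[OF \<pi>] by blast
  have z: "[cyc n \<pi> (int z) + m = 0] (mod ?N)"
    using cong_add[OF z0 cong_refl[of m]] by simp
  note eq = toric_shift_eq[OF \<pi> z]
  have inj: "inj_on ?\<sigma> {1..n}"
  proof (rule inj_onI)
    fix i j assume ij: "i \<in> {1..n}" "j \<in> {1..n}" "?\<sigma> i = ?\<sigma> j"
    then have "[cyc n \<pi> (int z + int i) + m = cyc n \<pi> (int z + int j) + m] (mod ?N)"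
      by (simp add: eq cong_def eq_nat_nat_iff)
    then have "[int i = int j] (mod ?N)"
      using cyc_cong_iff[OF \<pi>] by (simp add: cong_add_rcancel cong_add_lcancel)
    then show "i = j"
      using ij by (simp add: cong_def)
  qed
  have "?\<sigma> i \<in> {1..n}" if i: "i \<in> {1..n}" for i
  proof -
    have "\<not> [int z + int i = int z + 0] (mod ?N)"
      using i unfolding cong_add_lcancel by (auto simp: cong_def)
    then have "\<not> [cyc n \<pi> (int z + int i) + m = cyc n \<pi> (int z) + m] (mod ?N)"
      using cyc_cong_iff[OF \<pi>] by (simp add: cong_add_rcancel)
    then have "0 < (cyc n \<pi> (int z + int i) + m) mod ?N"
      using z by (simp add: cong_def less_le)
    then show ?thesis
      using eq[OF i] nat_mod_le[of "cyc n \<pi> (int z + int i) + m" n] by simp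
  qed
  then have "?\<sigma> ` {1..n} = {1..n}"
    using inj by (intro endo_inj_surj) auto
  then have "bij_betw ?\<sigma> {1..n} {1..n}"
    using inj by (simp add: bij_betw_def)
  then show ?thesis
    by (rule bij_imp_permutes) (auto simp: toric_shift_def read_after_zero_def)
qed

text \<open>In these coordinates a toric shift is a translation, by \<open>z\<close> in positions
  and by \<open>m\<close> in values. Position \<open>0\<close> needs its own case because the shift
  is read off the word only on \<open>{1..n}\<close>; there both sides vanish by the choice of
  \<open>z\<close>.\<close>

lemma cyc_toric_shift:
  assumes \<pi>: "\<pi> permutes {1..n}" and z: "[cyc n \<pi> z + m = 0] (mod (int n + 1))"
  shows "cyc n (toric_shift n \<pi> m) i = (cyc n \<pi> (z + i) + m) mod (int n + 1)"
proof (cases "i mod (int n + 1) = 0")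
  case True
  then have "[z + i = z + 0] (mod (int n + 1))" "[i = 0] (mod (int n + 1))"
    unfolding cong_add_lcancel by (simp_all add: cong_def)
  then have "cyc n \<pi> (z + i) = cyc n \<pi> z" "cyc n (toric_shift n \<pi> m) i = 0"
    using cyc_cong[of i 0] cyc_0[OF toric_shift_permutes[OF \<pi>]] cyc_cong[of "z + i" z n \<pi>] by auto
  with z show ?thesis
    by (simp add: cong_def)
next
  case False
  let ?j = "nat (i mod (int n + 1))"
  have "0 < i mod (int n + 1)"
    using False by (simp add: less_le)
  then have j: "?j \<in> {1..n}" "int ?j = i mod (int n + 1)"
    using nat_mod_le[of i n] by auto
  have "cyc n \<pi> (z + int ?j) = cyc n \<pi> (z + i)"
    by (intro cyc_cong) (simp add: j cong_def mod_simps)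
  then show ?thesis
    using toric_shift_eq[OF \<pi> z j(1)] by (simp add: cyc_def[of n "toric_shift n \<pi> m"])
qed

text \<open>Equivalence is membership in a common class, so the point is that \<open>\<pi>\<close>
  lies in its own class, as its shift by \<open>0\<close>.\<close>

lemma toric_class_equiv:
  assumes "\<pi> permutes {1..n}" "0 \<le> m" "m \<le> int n"
  shows "torically_equiv n \<pi> (toric_shift n \<pi> m)"
proof -
  have "cyc n (toric_shift n \<pi> 0) i = cyc n \<pi> i" for i
    using cyc_toric_shift[OF assms(1), of 0 0 i] cyc_0[OF assms(1)] cyc_mod[OF assms(1)] by simp
  then have "toric_shift n \<pi> 0 = \<pi>"
    using assms(1) toric_shift_permutes by (intro permutes_eqI_cyc[of _ n]) auto
  then have "\<pi> \<in> toric_class n \<pi>"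
    unfolding toric_class_def by (metis (mono_tags, lifting) mem_Collect_eq of_nat_0_le_iff order_refl)
  moreover have "toric_shift n \<pi> m \<in> toric_class n \<pi>"
    using assms unfolding toric_class_def by auto
  ultimately show ?thesis
    unfolding torically_equiv_def using assms(1) by blast
qed

section \<open>Permutations with constant descent\<close>

text \<open>The circular word is a linear map of slope \<open>- c\<close> modulo
  \<open>n + 1\<close>, so that every step to the next position descends by \<open>c\<close> modulo
  \<open>n + 1\<close>.\<close>

definition steps_by :: "nat \<Rightarrow> int \<Rightarrow> (nat \<Rightarrow> nat) \<Rightarrow> bool" where
  "steps_by n c \<pi> \<longleftrightarrow> (\<forall>i. [cyc n \<pi> i = - c * i] (mod (int n + 1)))"

text \<open>The letter \<open>0\<close> at position \<open>0\<close> forces the constant term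
  \<open>e\<close> to vanish modulo \<open>n + 1\<close>.\<close>

lemma steps_byI:
  assumes \<pi>: "\<pi> permutes {1..n}" and e: "\<And>i. [cyc n \<pi> i = - c * i + e] (mod (int n + 1))"
  shows "steps_by n c \<pi>"
  unfolding steps_by_def
proof
  fix i
  have "[e = 0] (mod (int n + 1))"
    using e[of 0] cyc_0[OF \<pi>] by (simp add: cong_sym)
  from cong_add[OF cong_refl[of "- c * i"] this]
  show "[cyc n \<pi> i = - c * i] (mod (int n + 1))"
    using e[of i] cong_trans by fastforce
qed

text \<open>Translating positions and values changes an affine map only in its constant term, and
  \<open>steps_byI\<close> removes that term.\<close>

lemma steps_by_toric_shift_iff:
  assumes \<pi>: "\<pi> permutes {1..n}"
  shows "steps_by n c (toric_shift n \<pi> m) \<longleftrightarrow> steps_by n c \<pi>"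
proof -
  let ?N = "int n + 1"
  obtain z where z0: "[cyc n \<pi> (int z) = - m] (mod ?N)"
    using cyc_surj[OF \<pi>] by blast
  have z: "[cyc n \<pi> (int z) + m = 0] (mod ?N)"
    using cong_add[OF z0 cong_refl[of m]] by simp
  have shift: "[cyc n (toric_shift n \<pi> m) i = cyc n \<pi> (int z + i) + m] (mod ?N)" for i
    by (simp add: cyc_toric_shift[OF \<pi> z] cong_def)
  show ?thesis
  proof
    assume st: "steps_by n c (toric_shift n \<pi> m)"
    have "[cyc n \<pi> i = - c * i + (c * int z - m)] (mod ?N)" for i
    proof -
      have "[cyc n \<pi> i + m = - c * (i - int z)] (mod ?N)"
        using shift[of "i - int z"] st unfolding steps_by_def
        by (metis add_diff_cancel_left' add_diff_eq cong_sym cong_trans)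
      then show ?thesis
        by (simp add: cong_iff_dvd_diff algebra_simps)
    qed
    then show "steps_by n c \<pi>"
      by (rule steps_byI[OF \<pi>])
  next
    assume st: "steps_by n c \<pi>"
    have "[cyc n (toric_shift n \<pi> m) i = - c * i + (m - c * int z)] (mod ?N)" for i
    proof -
      have "[cyc n \<pi> (int z + i) + m = - c * (int z + i) + m] (mod ?N)"
        using st unfolding steps_by_def by (metis cong_add cong_refl)
      from cong_trans[OF shift this] show ?thesis
        by (simp add: algebra_simps)
    qed
    then show "steps_by n c (toric_shift n \<pi> m)"
      by (rule steps_byI[OF toric_shift_permutes[OF \<pi>]])
  qed
qed

lemma steps_by_unique:
  assumes "\<pi> permutes {1..n}" "\<sigma> permutes {1..n}" "steps_by n c \<pi>" "steps_by n c \<sigma>"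
  shows "\<pi> = \<sigma>"
proof (rule permutes_eqI_cyc[OF assms(1,2)])
  show "[cyc n \<pi> i = cyc n \<sigma> i] (mod (int n + 1))" for i
    using assms(3,4) unfolding steps_by_def by (metis cong_sym cong_trans)
qed

text \<open>The slope passes from \<open>\<pi>\<close> to the common \<open>\<rho>\<close> and on to
  \<open>\<sigma>\<close>, and it determines the permutation. Such toric classes are therefore
  singletons.\<close>

lemma steps_by_torically_equiv:
  assumes "steps_by n c \<pi>" "\<pi> permutes {1..n}" "torically_equiv n \<pi> \<sigma>" "\<sigma> permutes {1..n}"
  shows "\<sigma> = \<pi>"
proof -
  obtain \<rho> m m' where \<rho>: "\<rho> permutes {1..n}" "\<pi> = toric_shift n \<rho> m" "\<sigma> = toric_shift n \<rho> m'"
    using assms(3) unfolding torically_equiv_def toric_class_def by blast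
  then have "steps_by n c \<sigma>"
    using assms(1) steps_by_toric_shift_iff by blast
  then show ?thesis
    using assms steps_by_unique by blast
qed

text \<open>
  The positions of \<open>x + 1\<close> and \<open>x\<close> differ by \<open>k\<close>, so an occurrence puts them at \<open>a < k\<close> and
  \<open>b = a + (n + 1 - k)\<close>; every letter after position \<open>b\<close> is then smaller than \<open>x\<close>.
\<close>

lemma steps_by_avoids_213:
  assumes n: "n = k * c" and st: "steps_by n (int c) \<pi>"
    and \<pi>: "\<pi> permutes {1..n}"
  shows "avoids_213 n \<pi>"
  unfolding avoids_213_def occurs_213_def
proof (intro notI, elim exE conjE)
  fix a b e
  assume H: "1 \<le> a" "a < b" "b < e" "e \<le> n" "\<pi> b < \<pi> a" "\<pi> a < \<pi> e" "\<pi> a = \<pi> b + 1"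
  let ?N = "int n + 1" and ?k = "int k" and ?c = "int c"
  have nkc: "int n = ?k * ?c"
    by (simp add: n)
  have val: "[int (\<pi> i) = - ?c * int i] (mod ?N)" if "i \<le> n" for i
    using st that unfolding steps_by_def by (metis cyc_of_nat)
  have "[- ?c * int a = - ?c * int b + 1] (mod ?N)"
  proof -
    have "[int (\<pi> b) + 1 = - ?c * int b + 1] (mod ?N)"
      using val[of b] H by (intro cong_add) auto
    moreover have "[int (\<pi> b) + 1 = - ?c * int a] (mod ?N)"
      using val[of a] H by (simp add: add.commute)
    ultimately show ?thesis
      by (metis cong_sym cong_trans)
  qed
  \<comment> \<open>Since \<open>k * c = n\<close> is congruent to \<open>-1\<close>, multiplying by
    \<open>k\<close> inverts the slope and turns the relation between letters into one between
    positions.\<close>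
  then have "?N dvd ?k * (- ?c * int a - (- ?c * int b + 1))"
    by (simp add: cong_iff_dvd_diff)
  also have "?k * (- ?c * int a - (- ?c * int b + 1)) = ?N * (int b - int a) + (int a - int b - ?k)"
    by (simp add: nkc algebra_simps)
  finally have "?N dvd ?N * (int b - int a) - (?N * (int b - int a) + (int a - int b - ?k))"
    by (intro dvd_diff dvd_triv_left)
  also have "\<dots> = int b + ?k - int a"
    by simp
  finally obtain q where q: "int b + ?k - int a = ?N * q"
    by (elim dvdE)
  have c0: "0 < c" and k0: "0 < k"
    using H n by (auto intro!: Nat.gr0I)
  have kn: "k \<le> n"
    using c0 n by simp
  \<comment> \<open>From \<open>a < b\<close>, \<open>b \<le> n\<close> and
    \<open>k \<le> n\<close>, this multiple of \<open>n + 1\<close> lies strictly between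
    \<open>0\<close> and \<open>2 * (n + 1)\<close>.\<close>
  have "0 < ?N * q" "?N * q < ?N * 2"
    using q H kn by (auto simp flip: q)
  then have "q = 1"
    using mult_less_cancel_left_pos[of ?N q 2] zero_less_mult_iff[of ?N q] by simp
  then have b: "int b = int a + ?N - ?k"
    using q by simp
  \<comment> \<open>Beyond \<open>b\<close> the distance \<open>n + 1 - i\<close> is at most
    \<open>k\<close>, so \<open>c\<close> times it is at most \<open>n\<close> and equals the
    letter, not merely its residue.\<close>
  have after: "int (\<pi> i) = ?c * (?N - int i)" if i: "b \<le> i" "i \<le> n" for i
  proof -
    have "?c * (?N - int i) \<le> ?c * ?k"
      using i b H by (intro mult_left_mono) auto
    then have bound: "?c * (?N - int i) < ?N" "0 \<le> ?c * (?N - int i)"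
      using nkc i by (simp_all add: mult.commute)
    have "[- ?c * int i = ?c * (?N - int i)] (mod ?N)"
      unfolding cong_iff_dvd_diff by (rule dvdI[of _ _ "- ?c"]) (simp add: algebra_simps)
    then have "[int (\<pi> i) = ?c * (?N - int i)] (mod ?N)"
      using val[OF i(2)] cong_trans by blast
    moreover have "\<pi> i \<le> n"
      using permutes_in_image[OF permutes_from_0[OF \<pi>], of i] i by simp
    ultimately show ?thesis
      using bound by (simp add: cong_def)
  qed
  have "int (\<pi> e) \<le> int (\<pi> b)"
    using after[of e] after[of b] H by (simp add: mult_left_mono)
  then show False
    using H by simp
qed

section \<open>Divisor permutations\<close>

text \<open>Letter \<open>m\<close> stands at position \<open>m * k\<close>. As
  \<open>k * c = n\<close> is congruent to \<open>-1\<close>, multiplication by \<open>- c\<close>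
  inverts multiplication by \<open>k\<close> modulo \<open>n + 1\<close>, so position
  \<open>i\<close> carries the letter \<open>- c * i\<close>. This inverse also yields existence and
  uniqueness for the \<open>THE\<close> in \<open>step_word\<close>.\<close>

lemma divisor_perm_steps:
  assumes n: "n = k * c"
  shows "divisor_perm k n permutes {1..n}" "steps_by n (int c) (divisor_perm k n)"
proof -
  let ?N = "int n + 1" and ?k = "int k" and ?c = "int c"
  have nkc: "int n = ?k * ?c"
    by (simp add: n)
  define f where "f i = nat ((- ?c * int i) mod ?N)" for i
  have kf: "[v = - ?c * i] (mod ?N) \<longleftrightarrow> [v * ?k = i] (mod ?N)" for v i
  proof
    assume "[v = - ?c * i] (mod ?N)"
    then have "[v * ?k = - ?c * i * ?k] (mod ?N)"
      by (rule cong_scalar_right)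
    moreover have "[- ?c * i * ?k = i] (mod ?N)"
      unfolding cong_iff_dvd_diff by (rule dvdI[of _ _ "- i"]) (simp add: nkc algebra_simps)
    ultimately show "[v * ?k = i] (mod ?N)"
      by (rule cong_trans)
  next
    assume "[v * ?k = i] (mod ?N)"
    then have "[- ?c * (v * ?k) = - ?c * i] (mod ?N)"
      by (rule cong_scalar_left)
    moreover have "[v = - ?c * (v * ?k)] (mod ?N)"
      unfolding cong_iff_dvd_diff by (rule dvdI[of _ _ v]) (simp add: nkc algebra_simps)
    ultimately show "[v = - ?c * i] (mod ?N)"
      by (blast intro: cong_trans)
  qed
  have f_le: "f i \<le> n" for i
    unfolding f_def by (rule nat_mod_le)
  have f_iff: "letter_pos k n m = i \<longleftrightarrow> m = f i" if "m \<le> n" "i \<le> n" for m i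
  proof -
    have "letter_pos k n m = i \<longleftrightarrow> int (m * k mod (n + 1)) = int i"
      unfolding letter_pos_eq by simp
    also have "\<dots> \<longleftrightarrow> [int m * ?k = int i] (mod ?N)"
      using that by (simp add: zmod_int cong_def add.commute)
    also have "\<dots> \<longleftrightarrow> [int m = - ?c * int i] (mod ?N)"
      by (simp only: kf)
    also have "\<dots> \<longleftrightarrow> int m = (- ?c * int i) mod ?N"
      using that by (simp add: cong_def)
    also have "\<dots> \<longleftrightarrow> m = f i"
      unfolding f_def by auto
    finally show ?thesis .
  qed
  have word: "step_word k n i = f i" if "i \<le> n" for i
    unfolding step_word_def using f_iff f_le that by (intro the_equality) auto
  have f0: "f 0 = 0"
    by (simp add: f_def)
  have f_inj: "i = j" if "i \<le> n" "j \<le> n" "f i = f j" for i j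
    using f_iff[of "f i" i] f_iff[of "f j" j] f_le that by metis
  have "zero_pos n (step_word k n) = 0"
    unfolding zero_pos_def using word f0 f_inj by (intro the_equality) auto
  then have dp: "divisor_perm k n i = (if i \<in> {1..n} then f i else i)" for i
    by (simp add: divisor_perm_def nu_def read_after_zero_def word)
  have "f i \<in> {1..n}" if "i \<in> {1..n}" for i
    using f_le[of i] f0 f_inj[of i 0] that by (cases "f i") auto
  then have "f ` {1..n} \<subseteq> {1..n}"
    by blast
  moreover have "inj_on f {1..n}"
    by (auto intro!: inj_onI f_inj)
  ultimately have "bij_betw f {1..n} {1..n}"
    by (simp add: bij_betw_def endo_inj_surj)
  then have "bij_betw (divisor_perm k n) {1..n} {1..n}"
    by (subst bij_betw_cong[of _ _ f]) (auto simp: dp)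
  then show "divisor_perm k n permutes {1..n}"
    by (rule bij_imp_permutes) (auto simp: dp)
  show "steps_by n (int c) (divisor_perm k n)"
    unfolding steps_by_def
  proof
    fix i
    \<comment> \<open>Position \<open>0\<close> falls under the identity branch of the reading,
      which agrees with \<open>f 0 = 0\<close>.\<close>
    have "divisor_perm k n (nat (i mod ?N)) = f (nat (i mod ?N))"
      using nat_mod_le[of i n] f0 by (auto simp: dp)
    then have "[cyc n (divisor_perm k n) i = - ?c * int (nat (i mod ?N))] (mod ?N)"
      by (simp add: cyc_def f_def cong_def)
    also have "[- ?c * int (nat (i mod ?N)) = - ?c * i] (mod ?N)"
      by (intro cong_scalar_left) (simp add: cong_def)
    finally show "[cyc n (divisor_perm k n) i = - ?c * i] (mod ?N)" .
  qed
qed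

text \<open>Position \<open>1\<close> carries the letter \<open>- c\<close> modulo
  \<open>n + 1\<close>, which determines the complementary divisor \<open>c \<le> n\<close> and
  hence \<open>k\<close>.\<close>

lemma divisor_perm_inj: "inj_on (\<lambda>k. divisor_perm k n) {k. 0 < k \<and> k dvd n}" if "n \<ge> 1"
proof (rule inj_onI)
  fix k l
  assume "k \<in> {k. 0 < k \<and> k dvd n}" "l \<in> {k. 0 < k \<and> k dvd n}"
    and eq: "divisor_perm k n = divisor_perm l n"
  then have "k dvd n" "l dvd n"
    by simp_all
  then obtain c e where ce: "n = k * c" "n = l * e"
    unfolding dvd_def by blast
  have "[- int c * 1 = - int e * 1] (mod (int n + 1))"
    using divisor_perm_steps(2)[OF ce(1)] divisor_perm_steps(2)[OF ce(2)] eq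
    unfolding steps_by_def by (metis cong_sym cong_trans)
  then have "[int c = int e] (mod (int n + 1))"
    by (simp add: cong_minus_minus_iff)
  moreover have "c \<le> n" "e \<le> n"
    using ce that by (metis dvd_imp_le dvd_triv_right less_eq_Suc_le One_nat_def)+
  ultimately have "c = e"
    by (simp add: cong_def)
  then show "k = l"
    using ce that by (metis mult_cancel2 mult_0_right not_one_le_zero)
qed

section \<open>Toric avoiders have constant descent\<close>

text \<open>Monotonicity over the rest of one period gives
  \<open>k (i + 1) \<le> k (i + p) = k i\<close>, so no step can increase.\<close>

lemma periodic_incseq_const:
  fixes k :: "int \<Rightarrow> nat" and p :: int
  assumes mono: "\<And>i. k i \<le> k (i + 1)" and per: "\<And>i. k (i + p) = k i" and "0 < p"
  shows "k i = k 0"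
proof -
  have le: "k i \<le> k (i + int j)" for i j
  proof (induction j)
    case (Suc j)
    then show ?case
      using mono[of "i + int j"] by (simp add: algebra_simps)
  qed simp
  have "k (i + 1) \<le> k i" for i
    using le[of "i + 1" "nat (p - 1)"] per[of i] \<open>0 < p\<close> by simp
  then have step: "k (i + 1) = k i" for i
    using mono le_antisym by blast
  show ?thesis
  proof (induction i rule: int_induct[where k = 0])
    case (step2 i)
    then show ?case
      using step[of "i - 1"] by simp
  qed (simp_all add: step)
qed

text \<open>Suppose the arc from a letter \<open>x\<close> to \<open>x + 1\<close> wraps around
  between two neighbouring letters. Rotating the second of these to \<open>0\<close> puts
  \<open>x + 1\<close> before \<open>x\<close> and the first neighbour last, where it is large: an
  occurrence of the pattern.\<close>

lemma avoiding_arc_descends: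
  assumes \<pi>: "\<pi> permutes {1..n}" and av: "\<And>m. 0 \<le> m \<Longrightarrow> m \<le> int n \<Longrightarrow> avoids_213 n (toric_shift n \<pi> m)"
    and k: "1 \<le> k" "k \<le> n" "[cyc n \<pi> (i + int k) = cyc n \<pi> i + 1] (mod (int n + 1))"
    and j: "j < k"
  shows "(cyc n \<pi> i - cyc n \<pi> (i + int j)) mod (int n + 1)
       < (cyc n \<pi> i - cyc n \<pi> (i + int (Suc j))) mod (int n + 1)"
proof -
  let ?N = "int n + 1" and ?w = "cyc n \<pi>"
  \<comment> \<open>\<open>D l\<close> is the net descent modulo \<open>n + 1\<close> along the
    first \<open>l\<close> steps of the arc; over the whole arc it is \<open>-1\<close>, that is,
    \<open>n\<close>.\<close>
  define D where "D l = (?w i - ?w (i + int l)) mod ?N" for l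
  have D_range: "0 \<le> D l" "D l \<le> int n" for l
    using pos_mod_bound[of ?N "?w i - ?w (i + int l)"] unfolding D_def by auto
  have D_inj: "l = l'" if "D l = D l'" "l \<le> n" "l' \<le> n" for l l'
  proof -
    have "[?w i - ?w (i + int l) = ?w i - ?w (i + int l')] (mod ?N)"
      using that by (simp add: D_def cong_def)
    then have "[?w (i + int l) = ?w (i + int l')] (mod ?N)"
      by (simp add: cong_iff_dvd_diff dvd_diff_commute)
    then have "[int l = int l'] (mod ?N)"
      using cyc_cong_iff[OF \<pi>] by (simp add: cong_add_lcancel)
    then show ?thesis
      using that by (simp add: cong_def)
  qed
  have D0: "D 0 = 0"
    by (simp add: D_def)
  have "[?w i - ?w (i + int k) = int n] (mod ?N)"
  proof -
    have "?N dvd (?w (i + int k) - (?w i + 1)) + ?N"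
      using dvd_add[OF k(3)[unfolded cong_iff_dvd_diff] dvd_refl] .
    then show ?thesis
      unfolding cong_iff_dvd_diff by (subst dvd_minus_iff[symmetric]) (simp add: algebra_simps)
  qed
  then have Dk: "D k = int n"
    by (simp add: D_def cong_def)
  have "D j < D (Suc j)"
  proof (rule ccontr)
    assume "\<not> D j < D (Suc j)"
    moreover have "D j \<noteq> D (Suc j)"
      using D_inj[of j "Suc j"] j k by auto
    ultimately have gt: "D (Suc j) < D j"
      by simp
    \<comment> \<open>A drop of \<open>D\<close> can neither start at the minimum
      \<open>D 0 = 0\<close> nor end at the maximum \<open>D k = n\<close>; hence
      \<open>0 < j\<close> and \<open>Suc j < k\<close>.\<close>
    then have j0: "0 < j"
      using D0 D_range(1)[of "Suc j"] by (auto intro!: Nat.gr0I)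
    have jk: "Suc j < k"
      using gt Dk D_range(2)[of j] j by (metis Suc_lessI not_le)
    \<comment> \<open>This strictness makes the last letter exceed the one playing the role of
      \<open>2\<close>.\<close>
    have Dj: "D j < int n"
      using D_inj[of j k] Dk D_range(2)[of j] j k by (metis less_le less_imp_le_nat order_trans order_less_irrefl)
    \<comment> \<open>The letter just after the wrap becomes \<open>0\<close>. Read from there,
      positions \<open>i\<close> and \<open>i + j\<close> are reached only after nearly a full turn,
      at places \<open>n - j\<close> and \<open>n\<close>.\<close>
    define z where "z = i + int (Suc j)"
    define m where "m = (- ?w z) mod ?N"
    have m: "0 \<le> m" "m \<le> int n"
      using pos_mod_bound[of ?N "- ?w z"] unfolding m_def by auto
    have zm: "[?w z + m = 0] (mod ?N)"
      by (simp add: m_def cong_def mod_simps)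
    let ?\<sigma> = "toric_shift n \<pi> m"
    have val: "int (?\<sigma> l) = (?w (z + int l) - ?w z) mod ?N" if "l \<le> n" for l
      using cyc_toric_shift[OF \<pi> zm, of "int l"] that by (simp add: cyc_of_nat m_def mod_simps)
    have wrap: "?w (l + ?N) = ?w l" for l
      by (rule cyc_cong) (simp add: cong_def)
    have b: "int (?\<sigma> (n - j)) = D (Suc j)"
      using val[of "n - j"] wrap[of i] j k
      by (simp add: z_def D_def of_nat_diff algebra_simps)
    have "(D (Suc j) + 1) mod ?N = (?w i + 1 - ?w z) mod ?N"
      unfolding D_def z_def by (simp add: mod_simps algebra_simps)
    also have "\<dots> = (?w (i + int k) - ?w z) mod ?N"
      using cong_diff[OF k(3) cong_refl[of "?w z"]] by (simp add: cong_def)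
    also have "\<dots> = int (?\<sigma> (k - Suc j))"
      using val[of "k - Suc j"] jk k by (simp add: z_def of_nat_diff)
    finally have a: "int (?\<sigma> (k - Suc j)) = D (Suc j) + 1"
      using D_range(1)[of "Suc j"] gt Dj by simp
    have "int (?\<sigma> n) = (?w (i + int j) - ?w z) mod ?N"
      using val[of n] wrap[of "i + int j"] by (simp add: z_def algebra_simps)
    also have "\<dots> = (D (Suc j) - D j) mod ?N"
      unfolding D_def z_def mod_diff_eq by simp
    also have "\<dots> = (D (Suc j) - D j + ?N) mod ?N"
      by simp
    also have "\<dots> = D (Suc j) - D j + ?N"
      using gt Dj D_range(1)[of "Suc j"] by (intro mod_pos_pos_trivial) linarith+
    finally have c: "int (?\<sigma> n) = D (Suc j) - D j + ?N" .
    have "occurs_213 n ?\<sigma> (k - Suc j) (n - j) n"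
      unfolding occurs_213_def using a b c j0 jk k Dj by auto
    then show False
      using av[OF m] unfolding avoids_213_def by blast
  qed
  then show ?thesis
    by (simp add: D_def)
qed

lemma toric_avoider_steps:
  assumes n: "n \<ge> 1" and \<pi>: "\<pi> \<in> toric_avoiders n"
  obtains k c where "n = k * c" "steps_by n (int c) \<pi>"
proof -
  let ?N = "int n + 1" and ?w = "cyc n \<pi>"
  have perm: "\<pi> permutes {1..n}"
    using \<pi> by (simp add: toric_avoiders_def)
  have av: "avoids_213 n (toric_shift n \<pi> m)" if "0 \<le> m" "m \<le> int n" for m
    using \<pi> toric_class_equiv[OF perm that] toric_shift_permutes[OF perm]
    by (simp add: toric_avoiders_def)
  define d where "d i = (?w i - ?w (i + 1)) mod ?N" for i
  have "\<exists>k. 1 \<le> k \<and> k \<le> n \<and> [?w (i + int k) = ?w i + 1] (mod ?N)" for i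
  proof -
    obtain l where l: "[?w (int l) = ?w i + 1] (mod ?N)"
      using cyc_surj[OF perm] by blast
    define k where "k = nat ((int l - i) mod ?N)"
    have "?w (i + int k) = ?w (int l)"
      by (rule cyc_cong) (simp add: k_def cong_def mod_simps)
    then have *: "[?w (i + int k) = ?w i + 1] (mod ?N)"
      using l by simp
    have "k \<noteq> 0"
    proof
      assume "k = 0"
      then have "[0 + ?w i = 1 + ?w i] (mod ?N)"
        using * by (simp add: add.commute)
      then show False
        using n unfolding cong_add_rcancel by (simp add: cong_def)
    qed
    moreover have "k \<le> n"
      unfolding k_def by (rule nat_mod_le)
    ultimately show ?thesis
      using * by (intro exI[of _ k]) simp
  qed
  then obtain k where k: "1 \<le> k i" "k i \<le> n" "[?w (i + int (k i)) = ?w i + 1] (mod ?N)" for i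
    by metis
  have d_pos: "0 < d i" for i
  proof -
    have "\<not> [i + 1 = i + 0] (mod ?N)"
      using n unfolding cong_add_lcancel by (simp add: cong_def)
    then have "\<not> [?w i = ?w (i + 1)] (mod ?N)"
      using cyc_cong_iff[OF perm] cong_sym by fastforce
    then have "d i \<noteq> 0"
      by (auto simp: d_def cong_iff_dvd_diff mod_eq_0_iff_dvd)
    then show ?thesis
      by (simp add: d_def less_le)
  qed
  \<comment> \<open>Since \<open>D\<close> increases along the arc without wrapping, its increments
    are the \<open>d\<close> values as integers, and the sum telescopes.\<close>
  have sum_d: "(\<Sum>j<k i. d (i + int j)) = int n" for i
  proof -
    define D where "D l = (?w i - ?w (i + int l)) mod ?N" for l
    have "d (i + int j) = D (Suc j) - D j" if "j < k i" for j
    proof -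
      have "D j < D (Suc j)"
        using avoiding_arc_descends[OF perm av k that] by (simp add: D_def)
      moreover have "0 \<le> D j" "D (Suc j) < ?N"
        unfolding D_def by (rule pos_mod_sign pos_mod_bound, simp)+
      ultimately have "D (Suc j) - D j = (D (Suc j) - D j) mod ?N"
        by simp
      also have "\<dots> = d (i + int j)"
        unfolding D_def d_def mod_diff_eq by (simp add: add_ac)
      finally show ?thesis ..
    qed
    then have "(\<Sum>j<k i. d (i + int j)) = D (k i) - D 0"
      by (simp add: sum_lessThan_telescope)
    moreover have "D 0 = 0"
      by (simp add: D_def)
    moreover have "D (k i) = int n"
    proof -
      have "D (k i) = (?w i - ?w (i + int (k i)) mod ?N) mod ?N"
        by (simp add: D_def mod_simps)
      also have "\<dots> = (?w i - (?w i + 1) mod ?N) mod ?N"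
        using k(3)[of i] by (simp add: cong_def)
      also have "\<dots> = (- 1) mod ?N"
        by (simp add: mod_simps)
      finally show ?thesis
        by (simp add: zmod_minus1)
    qed
    ultimately show ?thesis
      by simp
  qed
  have d_cong: "d i = d j" if "[i = j] (mod ?N)" for i j
    using cyc_cong[OF that] cyc_cong[of "i + 1" "j + 1" n \<pi>] that
    by (simp add: d_def cong_add_rcancel)
  \<comment> \<open>All \<open>d\<close> are positive, so the partial sums are strictly increasing
    and reach \<open>n\<close> only once. This pins down the arc length in terms of \<open>d\<close>
    alone.\<close>
  have k_unique: "l = k i" if l: "(\<Sum>j<l. d (i + int j)) = int n" for l i
  proof -
    have mono: "(\<Sum>j<p. d (i + int j)) < (\<Sum>j<q. d (i + int j))" if "p < q" for p q
      using that d_pos by (intro sum_strict_mono2[of _ _ p]) (auto intro: less_imp_le)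
    show ?thesis
      using mono[of l "k i"] mono[of "k i" l] l sum_d[of i] by (metis less_irrefl nat_neq_iff)
  qed
  have k_per: "k (i + ?N) = k i" for i
  proof -
    have "d (i + ?N + int j) = d (i + int j)" for j
      by (rule d_cong) (simp add: cong_iff_dvd_diff)
    then have "(\<Sum>j<k (i + ?N). d (i + int j)) = int n"
      using sum_d[of "i + ?N"] by simp
    then show ?thesis
      by (rule k_unique)
  qed
  \<comment> \<open>Otherwise the arc from \<open>i\<close> would contain the step at
    \<open>i\<close> followed by the whole arc from \<open>i + 1\<close>, for a total of at least
    \<open>d i + n > n\<close>.\<close>
  have k_mono: "k i \<le> k (i + 1)" for i
  proof (rule ccontr)
    assume "\<not> k i \<le> k (i + 1)"
    then have less: "Suc (k (i + 1)) \<le> k i"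
      by simp
    have "(\<Sum>j<Suc (k (i + 1)). d (i + int j)) = d i + (\<Sum>j<k (i + 1). d (i + 1 + int j))"
      by (subst sum.lessThan_Suc_shift) (simp add: algebra_simps)
    also have "\<dots> = d i + int n"
      by (simp add: sum_d)
    finally have "d i + int n \<le> (\<Sum>j<k i. d (i + int j))"
      using sum_mono2[of "{..<k i}" "{..<Suc (k (i + 1))}" "\<lambda>j. d (i + int j)"] less d_pos
      by (fastforce intro: less_imp_le)
    then show False
      using sum_d[of i] d_pos[of i] by simp
  qed
  have k_const: "k i = k 0" for i
    by (rule periodic_incseq_const[OF k_mono k_per]) simp
  have w_step: "[?w (i + int (k 0)) = ?w i + 1] (mod ?N)" for i
    using k(3)[of i] k_const[of i] by simp
  \<comment> \<open>Moving by \<open>k 0\<close> raises both letters whose difference is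
    \<open>d i\<close> by \<open>1\<close>.\<close>
  have d_step: "d (i + int (k 0)) = d i" for i
  proof -
    have "[?w (i + int (k 0)) - ?w (i + int (k 0) + 1) = ?w i + 1 - (?w (i + 1) + 1)] (mod ?N)"
      using w_step[of i] w_step[of "i + 1"] by (intro cong_diff) (simp_all add: algebra_simps)
    then show ?thesis
      by (simp add: d_def cong_def)
  qed
  have w_mult: "[?w (int l * int (k 0)) = int l] (mod ?N)" for l
  proof (induction l)
    case 0
    then show ?case
      by (simp add: cyc_0[OF perm])
  next
    case (Suc l)
    then show ?case
      using cong_trans[OF w_step[of "int l * int (k 0)"] cong_add[OF Suc cong_refl[of 1]]]
      by (simp add: algebra_simps)
  qed
  have d_mult: "d (int l * int (k 0)) = d 0" for l
  proof (induction l)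
    case (Suc l)
    then show ?case
      using d_step[of "int l * int (k 0)"] by (simp add: algebra_simps)
  qed simp
  \<comment> \<open>By \<open>w_mult\<close>, position \<open>i\<close> is congruent to its letter
    times \<open>k 0\<close>. It is thus reached from \<open>0\<close> by steps of length
    \<open>k 0\<close>, along which \<open>d\<close> is unchanged.\<close>
  have d_const: "d i = d 0" for i
  proof -
    have "[?w (int (nat (?w i)) * int (k 0)) = ?w i] (mod ?N)"
      using w_mult[of "nat (?w i)"] cyc_nonneg by simp
    then have "[int (nat (?w i)) * int (k 0) = i] (mod ?N)"
      using cyc_cong_iff[OF perm] by blast
    then show ?thesis
      using d_cong d_mult by metis
  qed
  define c where "c = nat (d 0)"
  have d_c: "d i = int c" for i
    using d_pos[of 0] d_const[of i] by (simp add: c_def)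
  \<comment> \<open>The arc from position \<open>0\<close> consists of \<open>k 0\<close> equal
    descents \<open>c\<close> with total \<open>n\<close>.\<close>
  have "int (k 0 * c) = int n"
    using sum_d[of 0] by (simp add: d_c)
  then have nkc: "n = k 0 * c"
    by (metis of_nat_eq_iff)
  have w_desc: "[?w (i + 1) = ?w i - int c] (mod ?N)" for i
  proof -
    have "[d i = ?w i - ?w (i + 1)] (mod ?N)"
      by (simp add: d_def cong_def)
    then have "[int c = ?w i - ?w (i + 1)] (mod ?N)"
      by (simp add: d_c)
    from cong_diff[OF cong_refl[of "?w i"] this] show ?thesis
      by (simp add: cong_sym)
  qed
  have w_nat: "[?w (int l) = - int c * int l] (mod ?N)" for l
  proof (induction l)
    case 0
    then show ?case
      by (simp add: cyc_0[OF perm])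
  next
    case (Suc l)
    have e: "int (Suc l) = int l + 1" "- int c * (int l + 1) = - int c * int l - int c"
      by (simp_all add: algebra_simps)
    show ?case
      unfolding e by (rule cong_trans[OF w_desc[of "int l"] cong_diff[OF Suc cong_refl[of "int c"]]])
  qed
  have "steps_by n (int c) \<pi>"
    unfolding steps_by_def
  proof
    fix i
    let ?j = "nat (i mod ?N)"
    have j: "[int ?j = i] (mod ?N)"
      by (simp add: cong_def)
    show "[?w i = - int c * i] (mod ?N)"
      using w_nat[of ?j] cyc_cong[OF j] cong_scalar_left[OF j] cong_trans by metis
  qed
  with nkc show ?thesis
    by (rule that)
qed

theorem theorem6p30:
  fixes n :: nat
  assumes "n \<ge> 1"
  shows "toric_avoiders n = {divisor_perm k n | k. 0 < k \<and> k dvd n}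
       \<and> card (toric_avoiders n) = card {k. 0 < k \<and> k dvd n}"
proof -
  have "\<pi> \<in> {divisor_perm k n | k. 0 < k \<and> k dvd n}" if \<pi>: "\<pi> \<in> toric_avoiders n" for \<pi>
  proof -
    obtain k c where kc: "n = k * c" "steps_by n (int c) \<pi>"
      using toric_avoider_steps[OF assms \<pi>] .
    have "\<pi> = divisor_perm k n"
      using \<pi> kc divisor_perm_steps[OF kc(1)] steps_by_unique
      by (auto simp: toric_avoiders_def)
    moreover have "0 < k" "k dvd n"
      using kc(1) assms by (auto intro!: Nat.gr0I)
    ultimately show ?thesis
      by blast
  qed
  \<comment> \<open>A divisor permutation is torically equivalent only to itself, so its own
    avoidance suffices.\<close>
  moreover have "divisor_perm k n \<in> toric_avoiders n" if "k dvd n" for k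
  proof -
    from that obtain c where n: "n = k * c" ..
    note steps = divisor_perm_steps[OF n]
    have "avoids_213 n (divisor_perm k n)"
      by (rule steps_by_avoids_213[OF n steps(2,1)])
    then show ?thesis
      using steps steps_by_torically_equiv unfolding toric_avoiders_def by blast
  qed
  ultimately have eq: "toric_avoiders n = (\<lambda>k. divisor_perm k n) ` {k. 0 < k \<and> k dvd n}"
    by blast
  then show ?thesis
    using card_image[OF divisor_perm_inj[OF assms]] by auto
qed

end
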